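(* Let $D$ be a Dedekind domain. Then for all ideals $\mathfrak{b}$ of $D$ and all nonempty subsets $S$ of $D$, if $\mathbf{a}_1$ and $\mathbf{a}_2$ are $\mathfrak{b}$-orderings of $S$, then $\alpha_i(S,\mathfrak{b},\mathbf{a}_1)=\alpha_i(S,\mathfrak{b},\mathbf{a}_2)$ for all $i=0,1,2,\dots$.
   Context: $\mathbb{N}=\{0,1,2,\dots\}$. For an ideal $\mathfrak{b}$ of $D$ (the zero ideal and the unit ideal are allowed), with $\mathfrak{b}^0=D$, put for $a\in D$ $$v_{\mathfrak{b}}(a)=\sup\{k\in\mathbb{N}: aD\subseteq\mathfrak{b}^k\}\in\mathbb{N}\cup\{+\infty\}.$$ A sequence $\mathbf{a}=(a_i)_{i=0}^\infty$ of elements of $S$ (repetitions allowed) is a $\mathfrak{b}$-ordering of $S$ if for all $i=1,2,3,\dots$ $$\sum_{j=0}^{i-1}v_{\mathfrak{b}}(a_i-a_j)=\min_{s\in S}\sum_{j=0}^{i-1}v_{\mathfrak{b}}(s-a_j)$$ ($a_0\in S$ is arbitrary). Its associated $\mathfrak{b}$-exponent sequence is $\alpha_i(S,\mathfrak{b},\mathbf{a})=\sum_{j=0}^{i-1}v_{\mathfrak{b}}(a_i-a_j)\in\mathbb{N}\cup\{+\infty\}$, with $\alpha_0(S,\mathfrak{b},\mathbf{a})=0$. *)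

theory Defs
  imports "HOL-Algebra.Algebra" "HOL-Library.Extended_Nat"
begin

section \<open>The field of fractions\<close>

definition frac_rel :: "('a, 'm) ring_scheme \<Rightarrow> (('a \<times> 'a) \<times> ('a \<times> 'a)) set" where
  "frac_rel R = {((a, b), (c, d)).
     a \<in> carrier R \<and> b \<in> carrier R - {\<zero>\<^bsub>R\<^esub>} \<and> c \<in> carrier R \<and> d \<in> carrier R - {\<zero>\<^bsub>R\<^esub>} \<and>
     a \<otimes>\<^bsub>R\<^esub> d = c \<otimes>\<^bsub>R\<^esub> b}"

definition fraction :: "('a, 'm) ring_scheme \<Rightarrow> 'a \<Rightarrow> 'a \<Rightarrow> ('a \<times> 'a) set" where
  "fraction R a b = frac_rel R `` {(a, b)}"

text \<open>The unions below range over all representatives of the two classes; for a domain each of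
  them is the single class obtained from any choice of representatives.\<close>

definition frac_field :: "('a, 'm) ring_scheme \<Rightarrow> ('a \<times> 'a) set ring" where
  "frac_field R =
    \<lparr> carrier = (carrier R \<times> (carrier R - {\<zero>\<^bsub>R\<^esub>})) // frac_rel R,
      monoid.mult = (\<lambda>x y. \<Union>(a, b)\<in>x. \<Union>(c, d)\<in>y. fraction R (a \<otimes>\<^bsub>R\<^esub> c) (b \<otimes>\<^bsub>R\<^esub> d)),
      one = fraction R \<one>\<^bsub>R\<^esub> \<one>\<^bsub>R\<^esub>,
      ring.zero = fraction R \<zero>\<^bsub>R\<^esub> \<one>\<^bsub>R\<^esub>,
      add = (\<lambda>x y. \<Union>(a, b)\<in>x. \<Union>(c, d)\<in>y.
               fraction R (a \<otimes>\<^bsub>R\<^esub> d \<oplus>\<^bsub>R\<^esub> c \<otimes>\<^bsub>R\<^esub> b) (b \<otimes>\<^bsub>R\<^esub> d)) \<rparr>"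

definition frac_embed :: "('a, 'm) ring_scheme \<Rightarrow> 'a \<Rightarrow> ('a \<times> 'a) set" where
  "frac_embed R a = fraction R a \<one>\<^bsub>R\<^esub>"

lemma UN_pair_const:
  assumes "\<And>a b c d. (a, b) \<in> A \<Longrightarrow> (c, d) \<in> B \<Longrightarrow> F a b c d = C"
    and "A \<noteq> {}" "B \<noteq> {}"
  shows "(\<Union>(a, b)\<in>A. \<Union>(c, d)\<in>B. F a b c d) = C"
proof -
  have "(\<Union>(a, b)\<in>A. \<Union>(c, d)\<in>B. F a b c d) = (\<Union>p\<in>A. \<Union>q\<in>B. C)"
    by (intro SUP_cong refl) (auto intro!: SUP_cong simp: assms(1))
  then show ?thesis using assms(2,3) by simp
qed

context domain
begin

lemma frac_rel_equiv: "equiv (carrier R \<times> (carrier R - {\<zero>})) (frac_rel R)"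
proof (rule equivI)
  show "frac_rel R \<subseteq> (carrier R \<times> (carrier R - {\<zero>})) \<times> (carrier R \<times> (carrier R - {\<zero>}))"
    by (auto simp: frac_rel_def)
  show "refl_on (carrier R \<times> (carrier R - {\<zero>})) (frac_rel R)"
    by (auto simp: refl_on_def frac_rel_def)
  show "sym (frac_rel R)"
    by (auto simp: sym_def frac_rel_def)
  show "trans (frac_rel R)"
  proof (rule transI)
    fix x y z assume "(x, y) \<in> frac_rel R" "(y, z) \<in> frac_rel R"
    then obtain a b c d e f where xyz: "x = (a, b)" "y = (c, d)" "z = (e, f)"
      and mem: "a \<in> carrier R" "b \<in> carrier R" "c \<in> carrier R" "d \<in> carrier R"
        "e \<in> carrier R" "f \<in> carrier R" "b \<noteq> \<zero>" "d \<noteq> \<zero>" "f \<noteq> \<zero>"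
      and eq: "a \<otimes> d = c \<otimes> b" "c \<otimes> f = e \<otimes> d"
      by (auto simp: frac_rel_def)
    have "d \<otimes> (a \<otimes> f) = (a \<otimes> d) \<otimes> f" using mem by algebra
    also have "\<dots> = (c \<otimes> f) \<otimes> b" unfolding eq(1) using mem by algebra
    also have "\<dots> = d \<otimes> (e \<otimes> b)" unfolding eq(2) using mem by algebra
    finally have "a \<otimes> f = e \<otimes> b" using mem by (simp add: m_lcancel)
    then show "(x, z) \<in> frac_rel R" using mem by (auto simp: frac_rel_def xyz)
  qed
qed

lemma frac_eq_iff:
  assumes "a \<in> carrier R" "b \<in> carrier R - {\<zero>}" "c \<in> carrier R" "d \<in> carrier R - {\<zero>}"
  shows "fraction R a b = fraction R c d \<longleftrightarrow> a \<otimes> d = c \<otimes> b"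
  unfolding fraction_def using assms
  by (subst eq_equiv_class_iff[OF frac_rel_equiv]) (auto simp: frac_rel_def)

lemma frac_self: "a \<in> carrier R \<Longrightarrow> b \<in> carrier R - {\<zero>} \<Longrightarrow> (a, b) \<in> fraction R a b"
  by (auto simp: fraction_def frac_rel_def)

lemma mem_fracD:
  assumes "(a', b') \<in> fraction R a b"
  shows "a \<in> carrier R" "b \<in> carrier R - {\<zero>}" "a' \<in> carrier R" "b' \<in> carrier R - {\<zero>}"
    "a' \<otimes> b = a \<otimes> b'"
  using assms by (auto simp: fraction_def frac_rel_def)

lemma frac_mult:
  assumes "a \<in> carrier R" "b \<in> carrier R - {\<zero>}" "c \<in> carrier R" "d \<in> carrier R - {\<zero>}"
  shows "fraction R a b \<otimes>\<^bsub>frac_field R\<^esub> fraction R c d = fraction R (a \<otimes> c) (b \<otimes> d)"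
proof -
  have "fraction R (a' \<otimes> c') (b' \<otimes> d') = fraction R (a \<otimes> c) (b \<otimes> d)"
    if p: "(a', b') \<in> fraction R a b" and q: "(c', d') \<in> fraction R c d" for a' b' c' d'
  proof -
    note m = mem_fracD[OF p] mem_fracD[OF q]
    have mc: "a \<in> carrier R" "b \<in> carrier R" "a' \<in> carrier R" "b' \<in> carrier R"
      "c \<in> carrier R" "d \<in> carrier R" "c' \<in> carrier R" "d' \<in> carrier R"
      using m by auto
    have "(a' \<otimes> c') \<otimes> (b \<otimes> d) = (a' \<otimes> b) \<otimes> (c' \<otimes> d)" using mc by algebra
    also have "\<dots> = (a \<otimes> c) \<otimes> (b' \<otimes> d')" unfolding m(5) m(10) using mc by algebra
    finally show ?thesis using m by (subst frac_eq_iff) (auto simp: integral_iff)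
  qed
  moreover have "fraction R a b \<noteq> {}" "fraction R c d \<noteq> {}"
    using frac_self[OF assms(1,2)] frac_self[OF assms(3,4)] by auto
  ultimately show ?thesis
    unfolding frac_field_def by (simp add: UN_pair_const)
qed

lemma frac_add:
  assumes "a \<in> carrier R" "b \<in> carrier R - {\<zero>}" "c \<in> carrier R" "d \<in> carrier R - {\<zero>}"
  shows "fraction R a b \<oplus>\<^bsub>frac_field R\<^esub> fraction R c d = fraction R (a \<otimes> d \<oplus> c \<otimes> b) (b \<otimes> d)"
proof -
  have "fraction R (a' \<otimes> d' \<oplus> c' \<otimes> b') (b' \<otimes> d') = fraction R (a \<otimes> d \<oplus> c \<otimes> b) (b \<otimes> d)"
    if p: "(a', b') \<in> fraction R a b" and q: "(c', d') \<in> fraction R c d" for a' b' c' d'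
  proof -
    note m = mem_fracD[OF p] mem_fracD[OF q]
    have mc: "a \<in> carrier R" "b \<in> carrier R" "a' \<in> carrier R" "b' \<in> carrier R"
      "c \<in> carrier R" "d \<in> carrier R" "c' \<in> carrier R" "d' \<in> carrier R"
      using m by auto
    have "(a' \<otimes> d' \<oplus> c' \<otimes> b') \<otimes> (b \<otimes> d)
        = (a' \<otimes> b) \<otimes> (d \<otimes> d') \<oplus> (c' \<otimes> d) \<otimes> (b \<otimes> b')" using mc by algebra
    also have "\<dots> = (a \<otimes> d \<oplus> c \<otimes> b) \<otimes> (b' \<otimes> d')" unfolding m(5) m(10) using mc by algebra
    finally show ?thesis using m by (subst frac_eq_iff) (auto simp: integral_iff)
  qed
  moreover have "fraction R a b \<noteq> {}" "fraction R c d \<noteq> {}"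
    using frac_self[OF assms(1,2)] frac_self[OF assms(3,4)] by auto
  ultimately show ?thesis
    unfolding frac_field_def by (simp add: UN_pair_const)
qed

lemma frac_field_carrier:
  "carrier (frac_field R) = {fraction R a b | a b. a \<in> carrier R \<and> b \<in> carrier R - {\<zero>}}"
  by (auto simp: frac_field_def fraction_def quotient_def)

lemma frac_zero_one:
  "\<zero>\<^bsub>frac_field R\<^esub> = fraction R \<zero> \<one>" "\<one>\<^bsub>frac_field R\<^esub> = fraction R \<one> \<one>"
  by (simp_all add: frac_field_def)

lemma frac_in_carrier:
  "a \<in> carrier R \<Longrightarrow> b \<in> carrier R - {\<zero>} \<Longrightarrow> fraction R a b \<in> carrier (frac_field R)"
  by (auto simp: frac_field_carrier)

lemma frac_cases:
  assumes "x \<in> carrier (frac_field R)"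
  obtains a b where "x = fraction R a b" "a \<in> carrier R" "b \<in> carrier R" "b \<noteq> \<zero>"
  using assms by (auto simp: frac_field_carrier)

lemma frac_field_cring: "cring (frac_field R)"
proof (rule cringI)
  show "abelian_group (frac_field R)"
  proof (rule abelian_groupI)
    fix x y assume "x \<in> carrier (frac_field R)" "y \<in> carrier (frac_field R)"
    then show "x \<oplus>\<^bsub>frac_field R\<^esub> y \<in> carrier (frac_field R)"
      by (elim frac_cases) (auto simp: frac_add integral_iff intro!: frac_in_carrier)
  next
    show "\<zero>\<^bsub>frac_field R\<^esub> \<in> carrier (frac_field R)"
      by (auto simp: frac_zero_one intro!: frac_in_carrier)
  next
    fix x y z
    assume "x \<in> carrier (frac_field R)" "y \<in> carrier (frac_field R)" "z \<in> carrier (frac_field R)"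
    from \<open>x \<in> carrier (frac_field R)\<close> obtain a b
      where x: "x = fraction R a b" "a \<in> carrier R" "b \<in> carrier R" "b \<noteq> \<zero>"
      by (rule frac_cases)
    from \<open>y \<in> carrier (frac_field R)\<close> obtain c d
      where y: "y = fraction R c d" "c \<in> carrier R" "d \<in> carrier R" "d \<noteq> \<zero>"
      by (rule frac_cases)
    from \<open>z \<in> carrier (frac_field R)\<close> obtain e f
      where z: "z = fraction R e f" "e \<in> carrier R" "f \<in> carrier R" "f \<noteq> \<zero>"
      by (rule frac_cases)
    have "((a \<otimes> d \<oplus> c \<otimes> b) \<otimes> f \<oplus> e \<otimes> (b \<otimes> d)) \<otimes> (b \<otimes> (d \<otimes> f))
        = (a \<otimes> (d \<otimes> f) \<oplus> (c \<otimes> f \<oplus> e \<otimes> d) \<otimes> b) \<otimes> (b \<otimes> d \<otimes> f)"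
      using x(2,3) y(2,3) z(2,3) by algebra
    then show "x \<oplus>\<^bsub>frac_field R\<^esub> y \<oplus>\<^bsub>frac_field R\<^esub> z = x \<oplus>\<^bsub>frac_field R\<^esub> (y \<oplus>\<^bsub>frac_field R\<^esub> z)"
      using x(2-4) y(2-4) z(2-4)
      unfolding x(1) y(1) z(1)
      by (simp add: frac_add frac_mult integral_iff frac_eq_iff)
  next
    fix x y assume "x \<in> carrier (frac_field R)" "y \<in> carrier (frac_field R)"
    from \<open>x \<in> carrier (frac_field R)\<close> obtain a b
      where x: "x = fraction R a b" "a \<in> carrier R" "b \<in> carrier R" "b \<noteq> \<zero>"
      by (rule frac_cases)
    from \<open>y \<in> carrier (frac_field R)\<close> obtain c d
      where y: "y = fraction R c d" "c \<in> carrier R" "d \<in> carrier R" "d \<noteq> \<zero>"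
      by (rule frac_cases)
    have "(a \<otimes> d \<oplus> c \<otimes> b) \<otimes> (d \<otimes> b) = (c \<otimes> b \<oplus> a \<otimes> d) \<otimes> (b \<otimes> d)"
      using x(2,3) y(2,3) by algebra
    then show "x \<oplus>\<^bsub>frac_field R\<^esub> y = y \<oplus>\<^bsub>frac_field R\<^esub> x"
      using x(2-4) y(2-4)
      unfolding x(1) y(1)
      by (simp add: frac_add frac_mult integral_iff frac_eq_iff)
  next
    fix x assume "x \<in> carrier (frac_field R)"
    then show "\<zero>\<^bsub>frac_field R\<^esub> \<oplus>\<^bsub>frac_field R\<^esub> x = x"
      by (elim frac_cases) (simp add: frac_zero_one frac_add integral_iff frac_eq_iff)
  next
    fix x assume "x \<in> carrier (frac_field R)"
    then obtain a b where x: "x = fraction R a b" "a \<in> carrier R" "b \<in> carrier R" "b \<noteq> \<zero>"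
      by (rule frac_cases)
    have "(\<ominus> a \<otimes> b \<oplus> a \<otimes> b) = \<zero>" using x by algebra
    then have "fraction R (\<ominus> a) b \<oplus>\<^bsub>frac_field R\<^esub> x = \<zero>\<^bsub>frac_field R\<^esub>"
      using x by (simp add: frac_zero_one frac_add integral_iff frac_eq_iff)
    then show "\<exists>y\<in>carrier (frac_field R). y \<oplus>\<^bsub>frac_field R\<^esub> x = \<zero>\<^bsub>frac_field R\<^esub>"
      using x frac_in_carrier[of "\<ominus> a" b] by auto
  qed
next
  show "comm_monoid (frac_field R)"
  proof (rule comm_monoidI)
    fix x y assume "x \<in> carrier (frac_field R)" "y \<in> carrier (frac_field R)"
    then show "x \<otimes>\<^bsub>frac_field R\<^esub> y \<in> carrier (frac_field R)"
      by (elim frac_cases) (auto simp: frac_mult integral_iff intro!: frac_in_carrier)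
  next
    show "\<one>\<^bsub>frac_field R\<^esub> \<in> carrier (frac_field R)"
      by (auto simp: frac_zero_one intro!: frac_in_carrier)
  next
    fix x y z
    assume "x \<in> carrier (frac_field R)" "y \<in> carrier (frac_field R)" "z \<in> carrier (frac_field R)"
    then show "x \<otimes>\<^bsub>frac_field R\<^esub> y \<otimes>\<^bsub>frac_field R\<^esub> z = x \<otimes>\<^bsub>frac_field R\<^esub> (y \<otimes>\<^bsub>frac_field R\<^esub> z)"
      by (elim frac_cases) (simp add: frac_mult integral_iff m_assoc)
  next
    fix x assume "x \<in> carrier (frac_field R)"
    then show "\<one>\<^bsub>frac_field R\<^esub> \<otimes>\<^bsub>frac_field R\<^esub> x = x"
      by (elim frac_cases) (simp add: frac_zero_one frac_mult)
  next
    fix x y assume "x \<in> carrier (frac_field R)" "y \<in> carrier (frac_field R)"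
    then show "x \<otimes>\<^bsub>frac_field R\<^esub> y = y \<otimes>\<^bsub>frac_field R\<^esub> x"
      by (elim frac_cases) (simp add: frac_mult m_comm)
  qed
next
  fix x y z
  assume "x \<in> carrier (frac_field R)" "y \<in> carrier (frac_field R)" "z \<in> carrier (frac_field R)"
    from \<open>x \<in> carrier (frac_field R)\<close> obtain a b
      where x: "x = fraction R a b" "a \<in> carrier R" "b \<in> carrier R" "b \<noteq> \<zero>"
      by (rule frac_cases)
    from \<open>y \<in> carrier (frac_field R)\<close> obtain c d
      where y: "y = fraction R c d" "c \<in> carrier R" "d \<in> carrier R" "d \<noteq> \<zero>"
      by (rule frac_cases)
    from \<open>z \<in> carrier (frac_field R)\<close> obtain e f
      where z: "z = fraction R e f" "e \<in> carrier R" "f \<in> carrier R" "f \<noteq> \<zero>"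
      by (rule frac_cases)
    have "(a \<otimes> d \<oplus> c \<otimes> b) \<otimes> e \<otimes> (b \<otimes> f \<otimes> (d \<otimes> f))
        = (a \<otimes> e \<otimes> (d \<otimes> f) \<oplus> c \<otimes> e \<otimes> (b \<otimes> f)) \<otimes> (b \<otimes> d \<otimes> f)"
      using x(2,3) y(2,3) z(2,3) by algebra
    then show "(x \<oplus>\<^bsub>frac_field R\<^esub> y) \<otimes>\<^bsub>frac_field R\<^esub> z
      = x \<otimes>\<^bsub>frac_field R\<^esub> z \<oplus>\<^bsub>frac_field R\<^esub> y \<otimes>\<^bsub>frac_field R\<^esub> z"
      using x(2-4) y(2-4) z(2-4)
      unfolding x(1) y(1) z(1)
      by (simp add: frac_add frac_mult integral_iff frac_eq_iff)
qed

theorem frac_field_field: "field (frac_field R)"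
proof -
  interpret K: cring "frac_field R" by (rule frac_field_cring)
  show ?thesis
  proof (rule K.cring_fieldI2)
    show "\<zero>\<^bsub>frac_field R\<^esub> \<noteq> \<one>\<^bsub>frac_field R\<^esub>"
      by (simp add: frac_zero_one frac_eq_iff)
    fix x assume "x \<in> carrier (frac_field R)" "x \<noteq> \<zero>\<^bsub>frac_field R\<^esub>"
    then obtain a b where x: "x = fraction R a b" "a \<in> carrier R" "b \<in> carrier R" "b \<noteq> \<zero>"
      and nz: "a \<noteq> \<zero>"
      by (elim frac_cases) (auto simp: frac_zero_one frac_eq_iff)
    then have "x \<otimes>\<^bsub>frac_field R\<^esub> fraction R b a = \<one>\<^bsub>frac_field R\<^esub>"
      by (simp add: frac_zero_one frac_mult integral_iff frac_eq_iff m_comm)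
    then show "\<exists>y\<in>carrier (frac_field R). x \<otimes>\<^bsub>frac_field R\<^esub> y = \<one>\<^bsub>frac_field R\<^esub>"
      using x nz frac_in_carrier[of b a] by auto
  qed
qed

lemma frac_embed_hom: "frac_embed R \<in> ring_hom R (frac_field R)"
  by (rule ring_hom_memI)
    (auto simp: frac_embed_def frac_mult frac_add frac_zero_one intro!: frac_in_carrier)

lemma frac_embed_inj: "inj_on (frac_embed R) (carrier R)"
  by (auto simp: inj_on_def frac_embed_def frac_eq_iff)

end


section \<open>Dedekind domains\<close>

text \<open>Coefficient lists have the leading coefficient first, as in \<^theory>\<open>HOL-Algebra.Polynomials\<close>.\<close>

definition integral_over :: "('a, 'm) ring_scheme \<Rightarrow> ('a \<times> 'a) set \<Rightarrow> bool" where
  "integral_over R x \<longleftrightarrow>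
    (\<exists>p. p \<noteq> [] \<and> set p \<subseteq> carrier R \<and> hd p = \<one>\<^bsub>R\<^esub> \<and>
         ring.eval (frac_field R) (map (frac_embed R) p) x = \<zero>\<^bsub>frac_field R\<^esub>)"

text \<open>Fields are admitted as Dedekind domains.\<close>

locale dedekind_domain = noetherian_domain R for R (structure) +
  assumes integrally_closed:
      "\<lbrakk> x \<in> carrier (frac_field R); integral_over R x \<rbrakk> \<Longrightarrow> x \<in> frac_embed R ` carrier R"
    and nonzero_prime_maximal:
      "\<lbrakk> primeideal P R; P \<noteq> {\<zero>} \<rbrakk> \<Longrightarrow> maximalideal P R"


section \<open>Orderings with respect to an ideal\<close>

text \<open>Powers of an ideal are taken in \<^const>\<open>ideals_set\<close>, whose unit is the unit ideal, so the
  zeroth power is \<^term>\<open>carrier R\<close> for every ideal, the zero ideal included. In \<^typ>\<open>enat\<close> the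
  supremum of an unbounded set is \<open>\<infinity>\<close>.\<close>

definition ideal_val :: "('a, 'm) ring_scheme \<Rightarrow> 'a set \<Rightarrow> 'a \<Rightarrow> enat" where
  "ideal_val R \<bb> a =
    (SUP k \<in> {k::nat. PIdl\<^bsub>R\<^esub> a \<subseteq> \<bb> [^]\<^bsub>ideals_set R\<^esub> k}. enat k)"

text \<open>The infimum of a nonempty set of \<^typ>\<open>enat\<close> is its least element.\<close>

definition ideal_ordering ::
    "('a, 'm) ring_scheme \<Rightarrow> 'a set \<Rightarrow> 'a set \<Rightarrow> (nat \<Rightarrow> 'a) \<Rightarrow> bool" where
  "ideal_ordering R S \<bb> a \<longleftrightarrow>
    (\<forall>i. a i \<in> S) \<and>
    (\<forall>i\<ge>1. (\<Sum>j<i. ideal_val R \<bb> (a i \<ominus>\<^bsub>R\<^esub> a j)) =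
            (INF s\<in>S. \<Sum>j<i. ideal_val R \<bb> (s \<ominus>\<^bsub>R\<^esub> a j)))"

definition exponent_seq ::
    "('a, 'm) ring_scheme \<Rightarrow> 'a set \<Rightarrow> 'a set \<Rightarrow> (nat \<Rightarrow> 'a) \<Rightarrow> nat \<Rightarrow> enat" where
  "exponent_seq R S \<bb> a i = (\<Sum>j<i. ideal_val R \<bb> (a i \<ominus>\<^bsub>R\<^esub> a j))"

end

theory Submission
  imports Defs
begin

text \<open>The value \<open>v\<^sub>\<bb>(x - y)\<close> measures closeness of \<open>x\<close> and \<open>y\<close>: it is symmetric and, because the
  powers of \<open>\<bb>\<close> form a decreasing chain of additive subgroups, it satisfies the ultrametric
  inequality \<open>min (v x y) (v y z) \<le> v x z\<close>. A \<open>\<bb>\<close>-ordering is a sequence chosen greedily for this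
  closeness: each term has the least possible total closeness to its predecessors. The exponents
  of a greedy sequence depend only on the ultrametric, for the following reason.

  Let \<open>a\<close> and \<open>b\<close> be greedy and let \<open>n\<close> be given. Match \<open>b 0, \<dots>, b (n - 1)\<close> one after the other with
  distinct terms among \<open>a 0, \<dots>, a n\<close>, each time with the closest term still unmatched, and let
  \<open>a e\<close> be the term left over. By the ultrametric inequality, \<open>a e\<close> is no closer to any \<open>b j\<close> than to
  the partner of \<open>b j\<close> (lemma \<open>ex_far_from_targets\<close>). Hence the total closeness of \<open>a e\<close> to the \<open>n\<close>
  terms of \<open>b\<close>, which bounds the \<open>n\<close>-th exponent of \<open>b\<close> from above since \<open>b\<close> is greedy, is at most
  its total closeness to the other terms among \<open>a 0, \<dots>, a n\<close>. Finally, within a greedy sequence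
  the last term is the one with the largest total closeness to the others, so this is at most the
  \<open>n\<close>-th exponent of \<open>a\<close>. That last fact amounts to the stability of greedy choices: a term \<open>a e\<close>
  that was the best choice given its predecessors remains the best choice given also the terms
  chosen later (lemma \<open>greedy_exchange\<close>). Exchanging the roles of \<open>a\<close> and \<open>b\<close> gives equality.

  All comparisons add inequalities and never cancel a summand, which makes them valid for
  the value \<open>\<infinity>\<close>.\<close>


section \<open>Greedy sequences in an ultrametric closeness\<close>

locale ultrametric_closeness =
  fixes S :: "'a set" and v :: "'a \<Rightarrow> 'a \<Rightarrow> 'b :: {linorder, ordered_comm_monoid_add}"
  assumes sym: "x \<in> S \<Longrightarrow> y \<in> S \<Longrightarrow> v x y = v y x"
    and ultra: "x \<in> S \<Longrightarrow> y \<in> S \<Longrightarrow> z \<in> S \<Longrightarrow> min (v x y) (v y z) \<le> v x z"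
begin

definition greedy :: "(nat \<Rightarrow> 'a) \<Rightarrow> bool" where
  "greedy a \<longleftrightarrow> range a \<subseteq> S \<and> (\<forall>i. \<forall>s\<in>S. (\<Sum>j<i. v (a i) (a j)) \<le> (\<Sum>j<i. v s (a j)))"

text \<open>Greedy choices are stable: replacing \<open>a e\<close> by another element \<open>s\<close> does not lower the total
  closeness to the other terms, even when these include terms selected after \<open>a e\<close>. The induction
  on the number \<open>m\<close> of terms fails to be immediate only if the new term \<open>a m\<close> is closer to \<open>a e\<close> than to \<open>s\<close>. Then \<open>s\<close> is no closer to
  \<open>a e\<close> than to \<open>a m\<close>, and one compares \<open>a e\<close> with \<open>a m\<close> by the induction hypothesis and \<open>a m\<close> with
  \<open>s\<close> by greediness of \<open>a m\<close>.\<close>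

lemma greedy_exchange:
  assumes "greedy a" "e < m" "s \<in> S"
  shows "(\<Sum>i\<in>{..<m} - {e}. v (a e) (a i)) \<le> (\<Sum>i\<in>{..<m} - {e}. v s (a i))"
  using assms(2,3)
proof (induction m arbitrary: s)
  case 0
  then show ?case by simp
next
  case (Suc m)
  have a: "a i \<in> S" for i
    using assms(1) by (auto simp: greedy_def)
  have least: "(\<Sum>j<i. v (a i) (a j)) \<le> (\<Sum>j<i. v s (a j))" for i
    using assms(1) Suc.prems(2) by (auto simp: greedy_def)
  show ?case
  proof (cases "e = m")
    case True
    then have "{..<Suc m} - {e} = {..<m}" by auto
    with True least show ?thesis by simp
  next
    case False
    with Suc.prems have "e < m" by simp
    define A where "A = {..<m} - {e}"
    have A: "{..<Suc m} - {e} = insert m A" "{..<m} = insert e A"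
      "m \<notin> A" "e \<notin> A" "finite A"
      using \<open>e < m\<close> by (auto simp: A_def)
    have IH: "(\<Sum>i\<in>A. v (a e) (a i)) \<le> (\<Sum>i\<in>A. v t (a i))" if "t \<in> S" for t
      using Suc.IH[OF \<open>e < m\<close> that] by (simp add: A_def)
    have "v (a e) (a m) + (\<Sum>i\<in>A. v (a e) (a i)) \<le> v s (a m) + (\<Sum>i\<in>A. v s (a i))"
    proof (cases "v (a e) (a m) \<le> v s (a m)")
      case True
      then show ?thesis using IH[OF Suc.prems(2)] by (rule add_mono)
    next
      case False
      then have "v s (a e) \<le> v s (a m)"
        using ultra[OF Suc.prems(2) a[of e] a[of m]] by (auto simp: min_le_iff_disj)
      have "v (a e) (a m) + (\<Sum>i\<in>A. v (a e) (a i)) \<le> v (a m) (a e) + (\<Sum>i\<in>A. v (a m) (a i))"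
        using IH[OF a] sym[OF a[of e] a[of m]] by (simp add: add_left_mono)
      also have "\<dots> \<le> v s (a e) + (\<Sum>i\<in>A. v s (a i))"
        using least[of m] A by simp
      also have "\<dots> \<le> v s (a m) + (\<Sum>i\<in>A. v s (a i))"
        using \<open>v s (a e) \<le> v s (a m)\<close> by (rule add_right_mono)
      finally show ?thesis .
    qed
    then show ?thesis using A by simp
  qed
qed

text \<open>For \<open>e < n\<close> the two sides arise from those of \<open>greedy_exchange\<close> for \<open>m = n\<close> and \<open>s = a n\<close> by
  adding the same summand, the closeness of \<open>a e\<close> and \<open>a n\<close>.\<close>

lemma greedy_last_closest:
  assumes "greedy a" "e \<le> n"
  shows "(\<Sum>i\<in>{..n} - {e}. v (a e) (a i)) \<le> (\<Sum>i<n. v (a n) (a i))"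
proof (cases "e = n")
  case True
  then have "{..n} - {e} = {..<n}" by auto
  with True show ?thesis by simp
next
  case False
  with assms have "e < n" by simp
  have a: "a i \<in> S" for i
    using assms(1) by (auto simp: greedy_def)
  define A where "A = {..<n} - {e}"
  have A: "{..n} - {e} = insert n A" "{..<n} = insert e A" "n \<notin> A" "e \<notin> A" "finite A"
    using \<open>e < n\<close> by (auto simp: A_def)
  have "(\<Sum>i\<in>A. v (a e) (a i)) \<le> (\<Sum>i\<in>A. v (a n) (a i))"
    using greedy_exchange[OF assms(1) \<open>e < n\<close> a] by (simp add: A_def)
  then show ?thesis
    using A sym[OF a[of e] a[of n]] by (simp add: add_left_mono)
qed

text \<open>The set \<open>E\<close> consists of the indices left unmatched after \<open>b 0, \<dots>, b (k - 1)\<close> have been matched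
  with terms of \<open>a\<close>. If \<open>a m\<close> is the unmatched term closest to \<open>b k\<close> and \<open>a e\<close> another unmatched
  term, then \<open>v (a e) (b k) \<le> v (b k) (a m)\<close>, so the ultrametric inequality gives
  \<open>v (a e) (b k) \<le> v (a e) (a m)\<close>.\<close>

lemma ex_unmatched_set:
  fixes a :: "'i \<Rightarrow> 'a" and b :: "nat \<Rightarrow> 'a"
  assumes "range a \<subseteq> S" "range b \<subseteq> S" "finite I" "k \<le> card I"
  shows "\<exists>E\<subseteq>I. card E = card I - k \<and>
           (\<forall>e\<in>E. (\<Sum>j<k. v (a e) (b j)) \<le> (\<Sum>i\<in>I - E. v (a e) (a i)))"
  using assms(4)
proof (induction k)
  case 0
  then show ?case by (intro exI[of _ I]) simp
next
  case (Suc k)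
  have S: "a i \<in> S" "b j \<in> S" for i j
    using assms(1,2) by auto
  obtain E where E: "E \<subseteq> I" "card E = card I - k"
    and le: "\<And>e. e \<in> E \<Longrightarrow> (\<Sum>j<k. v (a e) (b j)) \<le> (\<Sum>i\<in>I - E. v (a e) (a i))"
    using Suc by auto
  have "finite E" using E(1) assms(3) by (rule finite_subset)
  moreover have "E \<noteq> {}" using E(2) Suc.prems by auto
  ultimately have "Max ((\<lambda>i. v (b k) (a i)) ` E) \<in> (\<lambda>i. v (b k) (a i)) ` E"
    by (intro Max_in) auto
  then obtain m where "m \<in> E" and m: "v (b k) (a m) = Max ((\<lambda>i. v (b k) (a i)) ` E)"
    by auto
  have closest: "v (b k) (a e) \<le> v (b k) (a m)" if "e \<in> E" for e
    unfolding m using \<open>finite E\<close> that by (intro Max_ge) auto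
  have "(\<Sum>j<Suc k. v (a e) (b j)) \<le> (\<Sum>i\<in>I - (E - {m}). v (a e) (a i))"
    if "e \<in> E - {m}" for e
  proof -
    have "v (a e) (b k) \<le> v (b k) (a m)"
      using closest[of e] that sym[OF S(1) S(2), of e k] by simp
    then have "v (a e) (b k) \<le> v (a e) (a m)"
      using ultra[OF S(1)[of e] S(2)[of k] S(1)[of m]] by (simp add: min_def)
    then have "(\<Sum>j<Suc k. v (a e) (b j)) \<le> (\<Sum>i\<in>I - E. v (a e) (a i)) + v (a e) (a m)"
      using le[of e] that by (auto intro: add_mono)
    also have "\<dots> = (\<Sum>i\<in>insert m (I - E). v (a e) (a i))"
      using assms(3) \<open>m \<in> E\<close> by (simp add: add.commute)
    also have "insert m (I - E) = I - (E - {m})"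
      using \<open>m \<in> E\<close> E(1) by auto
    finally show ?thesis .
  qed
  moreover have "card (E - {m}) = card I - Suc k"
    using \<open>m \<in> E\<close> E(2) \<open>finite E\<close> by simp
  ultimately show ?case using E(1) by (intro exI[of _ "E - {m}"]) auto
qed

lemma ex_far_from_targets:
  fixes a b :: "nat \<Rightarrow> 'a"
  assumes "range a \<subseteq> S" "range b \<subseteq> S"
  shows "\<exists>e\<le>n. (\<Sum>j<n. v (a e) (b j)) \<le> (\<Sum>i\<in>{..n} - {e}. v (a e) (a i))"
proof -
  obtain E where E: "E \<subseteq> {..n}" "card E = 1"
    and le: "\<And>e. e \<in> E \<Longrightarrow> (\<Sum>j<n. v (a e) (b j)) \<le> (\<Sum>i\<in>{..n} - E. v (a e) (a i))"
    using ex_unmatched_set[OF assms, of "{..n}" n] by auto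
  from E(2) obtain e where "E = {e}" by (auto simp: card_1_singleton_iff)
  with E(1) le show ?thesis by auto
qed

lemma greedy_sum_le:
  assumes "greedy a" "greedy b"
  shows "(\<Sum>j<n. v (b n) (b j)) \<le> (\<Sum>j<n. v (a n) (a j))"
proof -
  have range: "range a \<subseteq> S" "range b \<subseteq> S"
    using assms by (auto simp: greedy_def)
  obtain e where e: "e \<le> n"
    "(\<Sum>j<n. v (a e) (b j)) \<le> (\<Sum>i\<in>{..n} - {e}. v (a e) (a i))"
    using ex_far_from_targets[OF range] by blast
  have "(\<Sum>j<n. v (b n) (b j)) \<le> (\<Sum>j<n. v (a e) (b j))"
    using assms(2) range(1) by (auto simp: greedy_def)
  also note e(2)
  also note greedy_last_closest[OF assms(1) e(1)]
  finally show ?thesis .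
qed

lemma greedy_sum_unique:
  assumes "greedy a" "greedy b"
  shows "(\<Sum>j<n. v (a n) (a j)) = (\<Sum>j<n. v (b n) (b j))"
  using greedy_sum_le[OF assms] greedy_sum_le[OF assms(2,1)] by (rule antisym[rotated])

end


section \<open>The ultrametric of an ideal\<close>

lemma (in ring) ideals_set_pow_ideal:
  assumes "ideal \<bb> R"
  shows "ideal (\<bb> [^]\<^bsub>ideals_set R\<^esub> (k::nat)) R"
  using assms by (induction k) (simp_all add: nat_pow_def ideals_set_def oneideal ideal_prod_is_ideal)

lemma (in ring) ideals_set_pow_antimono:
  assumes "ideal \<bb> R" "i \<le> k"
  shows "\<bb> [^]\<^bsub>ideals_set R\<^esub> (k::nat) \<subseteq> \<bb> [^]\<^bsub>ideals_set R\<^esub> i"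
  using assms(2)
proof (induction rule: dec_induct)
  case base
  show ?case by simp
next
  case (step k)
  have "\<bb> [^]\<^bsub>ideals_set R\<^esub> Suc k \<subseteq> \<bb> [^]\<^bsub>ideals_set R\<^esub> k"
    using ideal_prod_inter[OF ideals_set_pow_ideal[OF assms(1), of k] assms(1)]
    by (simp add: nat_pow_def ideals_set_def)
  with step.IH show ?case by blast
qed

lemma (in cring) cgenideal_subset_iff:
  assumes "ideal I R" "a \<in> carrier R"
  shows "PIdl a \<subseteq> I \<longleftrightarrow> a \<in> I"
  using cgenideal_self[OF assms(2)] cgenideal_minimal[OF assms(1)] by blast

lemma (in cring) ideal_val_altdef:
  assumes "ideal \<bb> R" "a \<in> carrier R"
  shows "ideal_val R \<bb> a = (SUP k\<in>{k. a \<in> \<bb> [^]\<^bsub>ideals_set R\<^esub> (k::nat)}. enat k)"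
  using assms by (simp add: ideal_val_def cgenideal_subset_iff ideals_set_pow_ideal)

lemma (in cring) ideal_val_minus:
  assumes "ideal \<bb> R" "a \<in> carrier R"
  shows "ideal_val R \<bb> (\<ominus> a) = ideal_val R \<bb> a"
proof -
  have "\<ominus> a \<in> \<bb> [^]\<^bsub>ideals_set R\<^esub> k \<longleftrightarrow> a \<in> \<bb> [^]\<^bsub>ideals_set R\<^esub> k" for k :: nat
  proof -
    interpret ideal "\<bb> [^]\<^bsub>ideals_set R\<^esub> k" R
      using assms(1) by (rule ideals_set_pow_ideal)
    show ?thesis
      using assms(2) a_inv_closed by (metis minus_minus)
  qed
  then show ?thesis using assms by (simp add: ideal_val_altdef)
qed

text \<open>The exponents \<open>k\<close> with \<open>a \<in> \<bb>\<^sup>k\<close> form an initial segment of the natural numbers, and so do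
  those with \<open>b \<in> \<bb>\<^sup>k\<close>. One of the two segments is contained in the other, hence consists of
  exponents \<open>k\<close> with \<open>a \<oplus> b \<in> \<bb>\<^sup>k\<close>.\<close>

lemma (in cring) ideal_val_add:
  assumes "ideal \<bb> R" "a \<in> carrier R" "b \<in> carrier R"
  shows "min (ideal_val R \<bb> a) (ideal_val R \<bb> b) \<le> ideal_val R \<bb> (a \<oplus> b)"
proof -
  define K where "K x = {k::nat. x \<in> \<bb> [^]\<^bsub>ideals_set R\<^esub> k}" for x
  have val: "ideal_val R \<bb> x = Sup (enat ` K x)" if "x \<in> carrier R" for x
    using assms(1) that by (simp add: K_def ideal_val_altdef)
  have "K a \<inter> K b \<subseteq> K (a \<oplus> b)"
    using additive_subgroup.a_closed[OF ideal.axioms(1)[OF ideals_set_pow_ideal[OF assms(1)]]]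
    by (auto simp: K_def)
  moreover have "K a \<subseteq> K b \<or> K b \<subseteq> K a"
    using ideals_set_pow_antimono[OF assms(1)] unfolding K_def
    by (smt (verit) mem_Collect_eq nat_le_linear subsetD subsetI)
  ultimately have "K a \<subseteq> K (a \<oplus> b) \<or> K b \<subseteq> K (a \<oplus> b)"
    by blast
  then have "ideal_val R \<bb> a \<le> ideal_val R \<bb> (a \<oplus> b) \<or>
      ideal_val R \<bb> b \<le> ideal_val R \<bb> (a \<oplus> b)"
    using assms(2,3) by (auto simp: val intro!: Sup_subset_mono image_mono)
  then show ?thesis by (auto simp: min_le_iff_disj)
qed

lemma (in cring) ultrametric_closeness_ideal_val:
  assumes "ideal \<bb> R" "S \<subseteq> carrier R"
  shows "ultrametric_closeness S (\<lambda>x y. ideal_val R \<bb> (x \<ominus> y))"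
proof
  fix x y assume "x \<in> S" "y \<in> S"
  with assms(2) have xy: "x \<in> carrier R" "y \<in> carrier R" by auto
  then have "x \<ominus> y = \<ominus> (y \<ominus> x)" by algebra
  then show "ideal_val R \<bb> (x \<ominus> y) = ideal_val R \<bb> (y \<ominus> x)"
    using xy assms(1) by (simp add: ideal_val_minus)
next
  fix x y z assume "x \<in> S" "y \<in> S" "z \<in> S"
  with assms(2) have xyz: "x \<in> carrier R" "y \<in> carrier R" "z \<in> carrier R" by auto
  then have "x \<ominus> z = (x \<ominus> y) \<oplus> (y \<ominus> z)" by algebra
  then show "min (ideal_val R \<bb> (x \<ominus> y)) (ideal_val R \<bb> (y \<ominus> z)) \<le> ideal_val R \<bb> (x \<ominus> z)"
    using xyz ideal_val_add[OF assms(1), of "x \<ominus> y" "y \<ominus> z"] by simp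
qed

lemma (in cring) ideal_ordering_imp_greedy:
  assumes "ideal \<bb> R" "S \<subseteq> carrier R" "ideal_ordering R S \<bb> a"
  shows "ultrametric_closeness.greedy S (\<lambda>x y. ideal_val R \<bb> (x \<ominus> y)) a"
proof -
  interpret ultrametric_closeness S "\<lambda>x y. ideal_val R \<bb> (x \<ominus> y)"
    using assms(1,2) by (rule ultrametric_closeness_ideal_val)
  have "(\<Sum>j<i. ideal_val R \<bb> (a i \<ominus> a j)) \<le> (\<Sum>j<i. ideal_val R \<bb> (s \<ominus> a j))"
    if "s \<in> S" for i s
  proof (cases "i = 0")
    case False
    then have "(\<Sum>j<i. ideal_val R \<bb> (a i \<ominus> a j)) =
        (INF s\<in>S. \<Sum>j<i. ideal_val R \<bb> (s \<ominus> a j))"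
      using assms(3) by (simp add: ideal_ordering_def)
    also have "\<dots> \<le> (\<Sum>j<i. ideal_val R \<bb> (s \<ominus> a j))"
      using that by (rule INF_lower)
    finally show ?thesis .
  qed simp
  then show ?thesis
    using assms(3) by (auto simp: greedy_def ideal_ordering_def)
qed

theorem theorem1p1:
  fixes D :: "('a, 'm) ring_scheme" and \<bb> S :: "'a set" and a\<^sub>1 a\<^sub>2 :: "nat \<Rightarrow> 'a"
  assumes "dedekind_domain D"
    and "ideal \<bb> D"
    and "S \<subseteq> carrier D" and "S \<noteq> {}"
    and "ideal_ordering D S \<bb> a\<^sub>1"
    and "ideal_ordering D S \<bb> a\<^sub>2"
  shows "\<forall>i. exponent_seq D S \<bb> a\<^sub>1 i = exponent_seq D S \<bb> a\<^sub>2 i"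
proof
  fix i
  interpret dedekind_domain D by fact
  interpret ultrametric_closeness S "\<lambda>x y. ideal_val D \<bb> (x \<ominus>\<^bsub>D\<^esub> y)"
    using assms(2,3) by (rule ultrametric_closeness_ideal_val)
  show "exponent_seq D S \<bb> a\<^sub>1 i = exponent_seq D S \<bb> a\<^sub>2 i"
    unfolding exponent_seq_def using assms(2,3,5,6)
    by (intro greedy_sum_unique ideal_ordering_imp_greedy)
qed

end
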